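(* For $j\in\mathbb{N}$ let $G_j(v)=\frac{v^j}{1-e^{-v}}$ ($v\ne0$, extended analytically at $0$) and $\mathfrak{g}_j(v)=(e^v-1)^{j+1}G_j^{(j)}(v)$. Then the Maclaurin power series of $\mathfrak{g}_j$ is \[ \mathfrak{g}_j(v)=(j+1)!\sum_{k=0}^\infty C(j,k)\frac{v^k}{k!}, \] where \[ C(j,k)=k!\sum_{r=0}^{k}(-1)^{r+1}(r+1)(r+2)(r+j)!\,\frac{S(k-r,j+1)}{(k-r)!}\sum_{q=0}^{r+1}\frac{(-1)^q}{q+1}\,\frac{S(r+q+1,q)}{(r-q+1)!\,(r+q+1)!}. \]
   Context: $\mathbb{N}=\{1,2,3,\dots\}$. $S(n,k)$ denotes the Stirling numbers of the second kind, defined by $\frac{(e^v-1)^k}{k!}=\sum_{n=k}^\infty S(n,k)\frac{v^n}{n!}$, with $S(n,k)=0$ for $n<k$. *)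

theory Defs
  imports "HOL-Analysis.Analysis" "HOL-Combinatorics.Stirling"
begin

text \<open>G_j(v) = v^j / (1 - e^(-v)) for v \<noteq> 0, extended analytically (continuously) at 0.
  For j \<ge> 1 the value at 0 is the limit: 1 if j = 1, and 0 if j \<ge> 2.\<close>
definition G :: "nat \<Rightarrow> real \<Rightarrow> real" where
  "G j v = (if v = 0 then (if j = 1 then 1 else 0) else v ^ j / (1 - exp (- v)))"

definition g :: "nat \<Rightarrow> real \<Rightarrow> real" where
  "g j v = (exp v - 1) ^ (j + 1) * (deriv ^^ j) (G j) v"

definition C :: "nat \<Rightarrow> nat \<Rightarrow> real" where
  "C j k = fact k * (\<Sum>r = 0..k. (-1) ^ (r + 1) * real (r + 1) * real (r + 2) * fact (r + j)
      * real (Stirling (k - r) (j + 1)) / fact (k - r)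
      * (\<Sum>q = 0..r + 1. (-1) ^ q / real (q + 1)
           * real (Stirling (r + q + 1) q) / (fact (r - q + 1) * fact (r + q + 1))))"

end

theory Submission
  imports Defs "HOL-Analysis.FPS_Convergence"
begin

text \<open>Both factors of \<open>g_j\<close> have Maclaurin series that can be computed formally.
  The exponential generating function of the Stirling numbers gives the coefficients
  \<open>k! S(n,k)/n!\<close> of \<open>(e^v - 1)^k\<close>. Writing \<open>\<phi>(v) = (e^v - 1)/v\<close>, we have
  \<open>1 - e^(-v) = v \<phi>(-v)\<close>, so \<open>G_j(v) = v^(j-1)/\<phi>(-v)\<close>. Since \<open>\<phi>(0) = 1\<close>, the inverse
  \<open>1/\<phi>\<close> agrees up to order \<open>m\<close> with the truncated geometric series
  \<open>\<Sum>q\<le>m. (1 - \<phi>)^q\<close>; expanding binomially expresses its \<open>m\<close>-th coefficient through the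
  coefficients of \<open>\<phi>^q = v^(-q) (e^v - 1)^q\<close>, i.e. again through Stirling numbers. The
  Cauchy product of the two series, after \<open>j\<close> formal differentiations of the second,
  is exactly \<open>(j+1)! C(j,k)/k!\<close>.\<close>

lemma fps_nth_conv_deriv':
  fixes f :: "'a :: {banach, real_normed_field} fps"
  assumes "fps_conv_radius f > 0"
  shows   "fps_nth f n = (deriv ^^ n) (eval_fps f) 0 / fact n"
  using assms
proof (induction n arbitrary: f)
  case 0
  thus ?case by (simp add: eval_fps_def)
next
  case (Suc n f)
  have "eventually (\<lambda>z. z \<in> eball 0 (fps_conv_radius f)) (nhds 0)"
    using Suc.prems by (intro eventually_nhds_in_open) (auto simp: zero_ereal_def)
  hence "eventually (\<lambda>z. deriv (eval_fps f) z = eval_fps (fps_deriv f) z) (nhds 0)"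
    by eventually_elim (simp add: eval_fps_deriv)
  hence "(deriv ^^ Suc n) (eval_fps f) 0 = (deriv ^^ n) (eval_fps (fps_deriv f)) 0"
    unfolding funpow_Suc_right o_def by (intro higher_deriv_cong_ev refl)
  also have "\<dots> / fact n = fps_nth (fps_deriv f) n"
    using Suc.prems fps_conv_radius_deriv[of f] by (intro Suc.IH [symmetric]) auto
  finally show ?case by (simp add: field_split_simps del: of_nat_Suc)
qed

lemma fps_nth_fps_expansion':
  fixes f :: "'a :: {banach, real_normed_field} \<Rightarrow> 'a"
  assumes "f has_fps_expansion F"
  shows   "fps_nth F n = (deriv ^^ n) f 0 / fact n"
proof -
  have "fps_nth F n = (deriv ^^ n) (eval_fps F) 0 / fact n"
    using assms by (intro fps_nth_conv_deriv') (auto simp: has_fps_expansion_def)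
  also have "(deriv ^^ n) (eval_fps F) 0 = (deriv ^^ n) f 0"
    using assms by (intro higher_deriv_cong_ev) (auto simp: has_fps_expansion_def)
  finally show ?thesis .
qed

lemma has_fps_expansion_higher_deriv:
  "f has_fps_expansion F \<Longrightarrow> (deriv ^^ n) f has_fps_expansion (fps_deriv ^^ n) F"
  by (induction n) (auto intro: has_fps_expansion_deriv)

lemma has_fps_expansion_power:
  fixes F :: "'a :: {banach, real_normed_field} fps"
  shows "f has_fps_expansion F \<Longrightarrow> (\<lambda>x. f x ^ n) has_fps_expansion F ^ n"
  by (induction n) (auto intro!: has_fps_expansion_mult)

lemma fps_nth_higher_deriv:
  "fps_nth ((fps_deriv ^^ j) (f :: 'a :: field_char_0 fps)) r
     = fact (r + j) / fact r * fps_nth f (r + j)"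
proof (induction j arbitrary: r)
  case (Suc j r)
  have "fps_nth ((fps_deriv ^^ Suc j) f) r = of_nat (Suc r) * fps_nth ((fps_deriv ^^ j) f) (Suc r)"
    by simp
  also have "\<dots> = fact (r + Suc j) / fact r * fps_nth f (r + Suc j)"
    by (simp add: Suc.IH field_simps del: of_nat_Suc)
  finally show ?case .
qed simp

lemma fps_nth_exp_minus_1_power:
  "fps_nth ((fps_exp 1 - 1 :: 'a :: field_char_0 fps) ^ k) n
     = fact k * of_nat (Stirling n k) / fact n"
proof (induction n arbitrary: k)
  case 0
  show ?case by (cases k) (simp_all add: fps_nth_power_0)
next
  case (Suc n k)
  let ?E = "fps_exp 1 - 1 :: 'a fps"
  show ?case
  proof (cases k)
    case (Suc m)
    have "fps_deriv ?E = ?E + 1"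
      by simp
    then have "fps_deriv (?E ^ k) = fps_const (of_nat k) * (?E ^ k + ?E ^ m)"
      by (simp only: Suc fps_deriv_power diff_Suc_1) (simp add: algebra_simps)
    then have "of_nat (Suc n) * fps_nth (?E ^ k) (Suc n)
             = of_nat k * (fps_nth (?E ^ k) n + fps_nth (?E ^ m) n)"
      by (simp only: fps_deriv_nth [symmetric] Suc_eq_plus1 fps_mult_left_const_nth fps_add_nth)
    also have "\<dots> = of_nat k * (fact k * of_nat (Stirling n k) + fact m * of_nat (Stirling n m))
                      / fact n"
      by (simp only: Suc.IH add_divide_distrib distrib_left times_divide_eq_right)
    also have "\<dots> = of_nat (Suc n) * (fact k * of_nat (Stirling (Suc n) k) / fact (Suc n))"
      by (simp add: Suc fact_Suc[of m] fact_Suc[of n] del: fact_Suc of_nat_Suc)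
         (simp add: algebra_simps)
    finally show ?thesis
      by (simp only: mult_left_cancel[OF of_nat_neq_0])
  qed simp
qed

lemma one_minus_power_one_minus:
  fixes x :: "'a :: comm_ring_1"
  shows "1 - (1 - x) ^ Suc m = x * (\<Sum>q=0..m. (-1) ^ q * of_nat (Suc m choose Suc q) * x ^ q)"
proof -
  have "(1 - x) ^ Suc m = (\<Sum>k=0..Suc m. of_nat (Suc m choose k) * (-x) ^ k)"
    using binomial_ring[of "-x" 1 "Suc m"] by (simp add: atMost_atLeast0)
  also have "\<dots> = 1 - x * (\<Sum>q=0..m. (-1) ^ q * of_nat (Suc m choose Suc q) * x ^ q)"
    by (simp only: sum.atLeast0_atMost_Suc_shift)
       (simp add: sum_distrib_left power_minus[of x] sum_negf algebra_simps del: binomial_Suc_Suc)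
  finally show ?thesis by simp
qed

lemma fps_nth_inverse_eq_sum_powers:
  fixes f :: "'a :: field fps"
  assumes "fps_nth f 0 = 1"
  shows "fps_nth (inverse f) m
           = (\<Sum>q=0..m. (-1) ^ q * of_nat (Suc m choose Suc q) * fps_nth (f ^ q) m)"
proof -
  define S where "S = (\<Sum>q=0..m. (-1) ^ q * of_nat (Suc m choose Suc q) * f ^ q)"
  define w where "w = fps_shift 1 (1 - f)"
  have "1 - f = fps_X * w"
    using assms unfolding w_def by (intro fps_ext) (simp add: fps_X_mult_nth)
  then have fS: "f * S = 1 - fps_X ^ Suc m * w ^ Suc m"
    unfolding S_def one_minus_power_one_minus [symmetric] by (metis power_mult_distrib)
  have "S = inverse f * (f * S)"
    using assms by (simp add: mult.assoc [symmetric] inverse_mult_eq_1)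
  also have "\<dots> = inverse f - fps_X ^ Suc m * (inverse f * w ^ Suc m)"
    by (simp only: fS right_diff_distrib mult_1_right mult.left_commute)
  finally have "fps_nth S m = fps_nth (inverse f) m"
    by (simp only: fps_sub_nth fps_X_power_mult_nth) simp
  moreover have "fps_nth S m
                   = (\<Sum>q=0..m. (-1) ^ q * of_nat (Suc m choose Suc q) * fps_nth (f ^ q) m)"
    unfolding S_def fps_sum_nth
  proof (intro sum.cong refl)
    fix q
    have "(-1) ^ q * of_nat (Suc m choose Suc q)
            = fps_const ((-1) ^ q * of_nat (Suc m choose Suc q) :: 'a)"
      by (simp only: fps_const_mult [symmetric] fps_const_power [symmetric] fps_const_neg [symmetric]
            fps_const_1_eq_1 fps_of_nat)
    then show "fps_nth ((-1) ^ q * of_nat (Suc m choose Suc q) * f ^ q) m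
                 = (-1) ^ q * of_nat (Suc m choose Suc q) * fps_nth (f ^ q) m"
      by (simp only: fps_mult_left_const_nth)
  qed
  ultimately show ?thesis
    by simp
qed

definition fps_expm1_over_X :: "'a :: field_char_0 fps" where
  "fps_expm1_over_X = fps_shift 1 (fps_exp 1 - 1)"

lemma fps_nth_expm1_over_X_0 [simp]: "fps_nth fps_expm1_over_X 0 = 1"
  by (simp add: fps_expm1_over_X_def)

lemma fps_X_times_expm1_over_X: "fps_X * fps_expm1_over_X = fps_exp 1 - 1"
  by (intro fps_ext) (simp add: fps_expm1_over_X_def fps_X_mult_nth)

lemma fps_nth_expm1_over_X_power:
  "fps_nth (fps_expm1_over_X ^ q) m
     = (fact q * of_nat (Stirling (m + q) q) / fact (m + q) :: 'a :: field_char_0)"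
proof -
  have "fps_nth (fps_expm1_over_X ^ q) m = fps_nth ((fps_exp 1 - 1 :: 'a fps) ^ q) (m + q)"
    by (simp add: fps_X_times_expm1_over_X [symmetric] power_mult_distrib fps_X_power_mult_nth)
  then show ?thesis
    by (simp add: fps_nth_exp_minus_1_power)
qed

text \<open>Written with \<open>r - q + 1\<close> as in \<open>C\<close>: for \<open>q = r + 1\<close> this is \<open>1\<close> rather than
  \<open>r + 1 - q = 0\<close>, which is harmless because \<open>0! = 1!\<close>.\<close>
lemma of_nat_choose_Suc_Suc_times_fact:
  assumes "q \<le> r + 1"
  shows "of_nat (Suc (Suc r) choose Suc q) * fact q
           = (fact (r + 2) / (of_nat (q + 1) * fact (r - q + 1)) :: 'a :: field_char_0)"
proof -
  have "fact (Suc r - q) = (fact (r - q + 1) :: nat)"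
    using assms by (cases "q \<le> r") (auto simp: Suc_diff_le)
  moreover have "fact (Suc q) * fact (Suc r - q) * (Suc (Suc r) choose Suc q)
                   = (fact (r + 2) :: nat)"
    using binomial_fact_lemma [of "Suc q" "Suc (Suc r)"] assms by simp
  ultimately have "of_nat (fact (Suc q) * fact (r - q + 1) * (Suc (Suc r) choose Suc q))
                     = (of_nat (fact (r + 2)) :: 'a)"
    by simp
  then have "fact (Suc q) * fact (r - q + 1) * of_nat (Suc (Suc r) choose Suc q)
               = (fact (r + 2) :: 'a)"
    by (simp only: of_nat_mult of_nat_fact)
  then show ?thesis
    by (simp add: fact_Suc [of q] field_simps del: binomial_Suc_Suc fact_Suc of_nat_Suc)
qed

definition C_inner :: "nat \<Rightarrow> 'a :: field_char_0" where
  "C_inner r = (\<Sum>q = 0..r + 1. (-1) ^ q / of_nat (q + 1)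
     * of_nat (Stirling (r + q + 1) q) / (fact (r - q + 1) * fact (r + q + 1)))"

lemma fps_nth_inverse_expm1_over_X:
  "fps_nth (inverse fps_expm1_over_X) (Suc r)
     = (fact r * of_nat (r + 1) * of_nat (r + 2) * C_inner r :: 'a :: field_char_0)"
proof -
  have "fps_nth (inverse fps_expm1_over_X) (Suc r) = (\<Sum>q = 0..r + 1.
          (-1) ^ q * (of_nat (Suc (Suc r) choose Suc q) * fact q)
            * of_nat (Stirling (r + q + 1) q) / (fact (r + q + 1) :: 'a))"
    by (simp add: fps_nth_inverse_eq_sum_powers fps_nth_expm1_over_X_power algebra_simps)
  also have "\<dots> = (\<Sum>q = 0..r + 1. fact r * of_nat (r + 1) * of_nat (r + 2)
          * ((-1) ^ q / of_nat (q + 1) * of_nat (Stirling (r + q + 1) q)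
              / (fact (r - q + 1) * fact (r + q + 1))))"
    by (intro sum.cong refl, simp only: atLeastAtMost_iff of_nat_choose_Suc_Suc_times_fact)
       (simp add: field_simps del: of_nat_Suc)
  finally show ?thesis
    by (simp only: C_inner_def sum_distrib_left)
qed

definition G_fps :: "nat \<Rightarrow> 'a :: field_char_0 fps" where
  "G_fps j = fps_X ^ (j - 1) * inverse (fps_expm1_over_X oo - fps_X)"

lemma G_has_fps_expansion:
  assumes "j \<ge> 1"
  shows "G j has_fps_expansion G_fps j"
proof -
  let ?D = "\<lambda>x::real. if x = 0 then 1 else (1 - exp (-x)) / x ^ 1"
  have "subdegree (1 - fps_exp (-1) :: real fps) = 1"
    by (rule subdegreeI) (auto simp: fps_exp_def)
  then have "?D has_fps_expansion fps_shift 1 (1 - fps_exp (-1))"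
    by (intro has_fps_expansion_shift) (auto intro!: fps_expansion_intros)
  also have "fps_shift 1 (1 - fps_exp (-1)) = fps_expm1_over_X oo - fps_X"
    by (intro fps_ext) (simp add: fps_compose_uminus' fps_expm1_over_X_def)
  finally have "(\<lambda>x. x ^ (j - 1) * inverse (?D x)) has_fps_expansion G_fps j"
    unfolding G_fps_def by (intro fps_expansion_intros) (simp_all add: fps_compose_uminus')
  also have "(\<lambda>x. x ^ (j - 1) * inverse (?D x)) = G j"
  proof
    fix x :: real
    have "x ^ j = x ^ (j - 1) * x"
      using assms by (simp flip: power_Suc2)
    then show "x ^ (j - 1) * inverse (?D x) = G j x"
      using assms by (auto simp: G_def field_simps)
  qed
  finally show ?thesis .
qed

lemma g_has_fps_expansion:
  assumes "j \<ge> 1"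
  shows "g j has_fps_expansion (fps_exp 1 - 1) ^ (j + 1) * (fps_deriv ^^ j) (G_fps j)"
  unfolding g_def [abs_def]
  by (intro has_fps_expansion_mult has_fps_expansion_power has_fps_expansion_higher_deriv
        G_has_fps_expansion assms fps_expansion_intros)

lemma fps_nth_higher_deriv_G_fps:
  assumes "j \<ge> 1"
  shows "fps_nth ((fps_deriv ^^ j) (G_fps j)) r
           = ((-1) ^ (r + 1) * of_nat (r + 1) * of_nat (r + 2) * fact (r + j) * C_inner r
               :: 'a :: field_char_0)"
proof -
  have "fps_nth (G_fps j) (r + j)
          = fps_nth (inverse (fps_expm1_over_X oo - fps_X) :: 'a fps) (Suc r)"
    using assms by (simp add: G_fps_def fps_X_power_mult_nth)
  also have "inverse (fps_expm1_over_X oo - fps_X)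
               = (inverse fps_expm1_over_X oo - fps_X :: 'a fps)"
    by (simp add: fps_inverse_compose)
  also have "fps_nth \<dots> (Suc r) = (-1) ^ Suc r * fps_nth (inverse fps_expm1_over_X) (Suc r)"
    by (simp only: fps_compose_uminus' fps_nth_Abs_fps)
  finally show ?thesis
    by (simp add: fps_nth_higher_deriv fps_nth_inverse_expm1_over_X)
qed

theorem theorem8p1:
  fixes j :: nat
  assumes "j \<ge> 1"
  shows "\<forall>k. (deriv ^^ k) (g j) 0 / fact k = fact (j + 1) * C j k / fact k"
proof
  fix k
  let ?E = "(fps_exp 1 - 1 :: real fps) ^ (j + 1)"
  let ?H = "(fps_deriv ^^ j) (G_fps j) :: real fps"
  have "(deriv ^^ k) (g j) 0 / fact k = fps_nth (?E * ?H) k"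
    by (rule fps_nth_fps_expansion' [OF g_has_fps_expansion [OF assms], symmetric])
  also have "\<dots> = fps_nth (?H * ?E) k"
    by (simp only: mult.commute)
  also have "\<dots> = (\<Sum>r = 0..k. fps_nth ?H r * fps_nth ?E (k - r))"
    by (rule fps_mult_nth)
  also have "\<dots> = fact (j + 1) * (\<Sum>r = 0..k. (-1) ^ (r + 1) * real (r + 1) * real (r + 2)
      * fact (r + j) * real (Stirling (k - r) (j + 1)) / fact (k - r) * C_inner r)"
    by (subst sum_distrib_left, intro sum.cong refl,
        simp only: fps_nth_higher_deriv_G_fps [OF assms] fps_nth_exp_minus_1_power)
       (simp only: times_divide_eq_left times_divide_eq_right mult_ac)
  also have "\<dots> = fact (j + 1) * C j k / fact k"
    by (simp add: C_def C_inner_def)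
  finally show "(deriv ^^ k) (g j) 0 / fact k = fact (j + 1) * C j k / fact k" .
qed

end
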